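(* Let $n_1$ be a positive integer, let $m_1,\dots,m_{n_1}$ be positive integers with $\sum_{i=1}^{n_1}m_i=n$, and let $\alpha_i>0$ for $i=1,\dots,n_1$. Partition $x\in\mathbb R^n$ as $x=(\bar x_1^T,\dots,\bar x_{n_1}^T)^T$ with $\bar x_i\in\mathbb R^{m_i}$, and suppose $\hat f:\mathbb R^n\to\mathbb R$ has the block-linearity property described in the context. Consider $$(R')\quad \min_{x\in\mathbb R^n}\hat f(x)\quad\text{s.t. } e^T\bar x_i=\alpha_i,\ i=1,\dots,n_1,\quad x\ge0.$$ Then there exists a global minimizer $x^*$ of $(R')$ such that $\|x^*\|_0=n_1$. Furthermore, $x^*$ is a global minimizer of $$\min_{x\in\mathbb R^n}\hat f(x)\quad\text{s.t. } e^T\bar x_i=\alpha_i,\ i=1,\dots,n_1,\quad x\ge0,\quad \|x\|_0\le n_1.$$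
   Context: $e$ denotes the all-ones vector of the appropriate dimension ($m_i$ in the $i$-th constraint); $\|x\|_0$ is the number of nonzero entries of $x$; inequalities are entrywise. For a block index $i$, $x_{-i}$ denotes the vector $x$ with its $i$-th block $\bar x_i$ removed. Block-linearity property of $\hat f$: $\hat f$ is differentiable and, for every $i\in\{1,\dots,n_1\}$, (i) $\hat f(x)$ is a linear (i.e. affine) function of $\bar x_i$, meaning that $\nabla_{\bar x_i}\hat f(x)$ does not depend on $\bar x_i$; and (ii) $\hat f(x)=\hat f^i(\bar x_i,x_{-i})+\hat f^{-i}(x_{-i})$, where $\hat f^{-i}$ depends only on $x_{-i}$ and $\hat f^i(\bar x_i,x_{-i})=\bar x_i^T\nabla_{\bar x_i}\hat f(x)$. *)

theory Defs
  imports "HOL-Analysis.Analysis"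
begin

(* The partition of the coordinates into blocks is a map blk that sends a coordinate to the
   number of its block; block i need not consist of consecutive coordinates. *)
definition block_partition :: "nat \<Rightarrow> (nat \<Rightarrow> nat) \<Rightarrow> ('n::finite \<Rightarrow> nat) \<Rightarrow> bool" where
  "block_partition n1 m blk \<longleftrightarrow>
     range blk \<subseteq> {1..n1} \<and> (\<forall>i\<in>{1..n1}. card {k. blk k = i} = m i)"

(* The i-th block of x and the vector x without its i-th block. Both are kept in the ambient
   space, with the missing coordinates padded by zeros, since their dimensions vary with i.
   Hence two vectors have the same i-th block (the same rest) iff the padded vectors agree,
   and a function depends only on the rest iff it factors through unblock blk i. *)
definition block :: "('n::finite \<Rightarrow> nat) \<Rightarrow> nat \<Rightarrow> real^'n \<Rightarrow> real^'n" where
  "block blk i x = (\<chi> k. if blk k = i then x $ k else 0)"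

definition unblock :: "('n::finite \<Rightarrow> nat) \<Rightarrow> nat \<Rightarrow> real^'n \<Rightarrow> real^'n" where
  "unblock blk i x = (\<chi> k. if blk k = i then 0 else x $ k)"

definition grad :: "(real^'n \<Rightarrow> real) \<Rightarrow> real^'n \<Rightarrow> real^'n::finite" where
  "grad f x = (\<chi> k. frechet_derivative f (at x) (axis k 1))"

definition block_grad :: "('n::finite \<Rightarrow> nat) \<Rightarrow> nat \<Rightarrow> (real^'n \<Rightarrow> real) \<Rightarrow> real^'n \<Rightarrow> real^'n" where
  "block_grad blk i f x = block blk i (grad f x)"

definition block_linear :: "nat \<Rightarrow> ('n::finite \<Rightarrow> nat) \<Rightarrow> (real^'n \<Rightarrow> real) \<Rightarrow> bool" where
  "block_linear n1 blk f \<longleftrightarrow>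
     (\<forall>x. f differentiable (at x)) \<and>
     (\<forall>i\<in>{1..n1}.
        (\<forall>x y. unblock blk i x = unblock blk i y \<longrightarrow>
               block_grad blk i f x = block_grad blk i f y) \<and>
        (\<exists>g. \<forall>x. f x = block blk i x \<bullet> block_grad blk i f x + g (unblock blk i x)))"

definition l0 :: "real^'n::finite \<Rightarrow> nat" where
  "l0 x = card {k. x $ k \<noteq> 0}"

definition feasible :: "nat \<Rightarrow> ('n::finite \<Rightarrow> nat) \<Rightarrow> (nat \<Rightarrow> real) \<Rightarrow> real^'n \<Rightarrow> bool" where
  "feasible n1 blk \<alpha> x \<longleftrightarrow>
     (\<forall>i\<in>{1..n1}. (\<Sum>k | blk k = i. x $ k) = \<alpha> i) \<and> 0 \<le> x"

end

(* With the other blocks fixed, f is affine in block i, so the whole mass alpha i can be moved to a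
   coordinate of block i with least partial derivative without increasing f. Doing this block by
   block, every feasible point is dominated by a vertex, a point with one nonzero entry per block.
   There are finitely many vertices, so the best vertex is a global minimizer. *)
theory Submission imports Defs begin

text \<open>If the blocks are nonempty and cover all coordinates and every \<open>\<alpha> i\<close>
  is nonnegative, the feasible set is a product of scaled simplices and these are its extreme
  points.\<close>

definition vertex :: "nat \<Rightarrow> ('n::finite \<Rightarrow> nat) \<Rightarrow> (nat \<Rightarrow> real) \<Rightarrow> real^'n \<Rightarrow> bool" where
  "vertex n1 blk \<alpha> x \<longleftrightarrow>
     feasible n1 blk \<alpha> x \<and> (\<forall>i\<in>{1..n1}. \<exists>k. blk k = i \<and> block blk i x = axis k (\<alpha> i))"

lemma unblock_eqD:
  assumes "unblock blk i x = unblock blk i y" "blk k \<noteq> i"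
  shows "x $ k = y $ k"
  using assms(2) arg_cong[OF assms(1), of "\<lambda>v. v $ k"] by (simp add: unblock_def)

lemma block_eq_axisD:
  assumes "block blk i x = axis k a" "blk l = i"
  shows "x $ l = (if l = k then a else 0)"
  using assms(2) arg_cong[OF assms(1), of "\<lambda>v. v $ l"]
  by (auto simp: block_def axis_def split: if_splits)

lemma inner_block:
  "block blk i x \<bullet> block blk i c = (\<Sum>k | blk k = i. x $ k * c $ k)"
proof -
  have "block blk i x \<bullet> block blk i c = (\<Sum>k\<in>UNIV. if blk k = i then x $ k * c $ k else 0)"
    by (auto simp: inner_vec_def block_def intro!: sum.cong)
  then show ?thesis by (simp add: sum.If_cases)
qed

text \<open>Points that agree outside block \<open>i\<close> share the block gradient
  \<open>c\<close> and the remainder term, so only the linear term in block \<open>i\<close> can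
  change. On the simplex of mass \<open>\<alpha> i\<close> that term is smallest when all mass sits
  at a least entry of \<open>c\<close>.\<close>

lemma block_linear_improve:
  assumes lin: "block_linear n1 blk f" and i: "i \<in> {1..n1}" and ne: "\<exists>k. blk k = i"
    and \<alpha>: "\<alpha> i \<ge> 0" and feas: "feasible n1 blk \<alpha> x"
  obtains y k where "feasible n1 blk \<alpha> y" "f y \<le> f x" "unblock blk i y = unblock blk i x"
    "blk k = i" "block blk i y = axis k (\<alpha> i)"
proof -
  define c where "c = grad f x"
  obtain k where k: "blk k = i" "\<And>l. blk l = i \<Longrightarrow> c $ k \<le> c $ l"
    using ne arg_min_if_finite(1)[of "{l. blk l = i}" "\<lambda>l. c $ l"]
      arg_min_least[of "{l. blk l = i}" _ "\<lambda>l. c $ l"] by auto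
  \<comment> \<open>Block \<open>i\<close> is erased and its whole mass is placed at the minimizing
    coordinate \<open>k\<close>.\<close>
  define y where "y = unblock blk i x + axis k (\<alpha> i)"
  have ub: "unblock blk i y = unblock blk i x"
    using k by (auto simp: y_def unblock_def axis_def vec_eq_iff)
  have b: "block blk i y = axis k (\<alpha> i)"
    using k by (auto simp: y_def unblock_def block_def axis_def vec_eq_iff)
  have y_in: "y $ l = (if l = k then \<alpha> i else 0)" if "blk l = i" for l
    using block_eq_axisD[OF b that] .
  have y_out: "y $ l = x $ l" if "blk l \<noteq> i" for l
    using unblock_eqD[OF ub that] .
  have x0: "x $ l \<ge> 0" for l
    using feas by (simp add: feasible_def less_eq_vec_def)
  have sx: "(\<Sum>l | blk l = i. x $ l) = \<alpha> i"
    using feas i by (simp add: feasible_def)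
  have sy: "(\<Sum>l | blk l = j. y $ l) = \<alpha> j" if j: "j \<in> {1..n1}" for j
  proof (cases "j = i")
    case True
    have "(\<Sum>l | blk l = i. y $ l) = (\<Sum>l | blk l = i. if l = k then \<alpha> i else 0)"
      by (intro sum.cong) (auto simp: y_in)
    with True k show ?thesis by simp
  next
    case False
    then have "(\<Sum>l | blk l = j. y $ l) = (\<Sum>l | blk l = j. x $ l)"
      by (intro sum.cong) (auto simp: y_out)
    with feas j show ?thesis by (simp add: feasible_def)
  qed
  have "y $ l \<ge> 0" for l
    using x0[of l] \<alpha> y_in[of l] y_out[of l] by (cases "blk l = i") auto
  with sy have fy: "feasible n1 blk \<alpha> y"
    by (simp add: feasible_def less_eq_vec_def)
  obtain g where g: "\<And>z. f z = block blk i z \<bullet> block_grad blk i f z + g (unblock blk i z)"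
    using lin i unfolding block_linear_def by metis
  \<comment> \<open>The coefficients \<open>c\<close> were taken at \<open>x\<close>; this makes
    them valid at \<open>y\<close> as well.\<close>
  have bg: "block_grad blk i f y = block_grad blk i f x"
    using lin i ub unfolding block_linear_def by blast
  have "block blk i y \<bullet> block blk i c = \<alpha> i * c $ k"
    unfolding b using k by (simp add: inner_axis' block_def)
  \<comment> \<open>By feasibility of \<open>x\<close>, the mass \<open>\<alpha> i\<close> is split
    into the entries of \<open>x\<close>, so that \<open>c $ k \<le> c $ l\<close> can be applied
    termwise with nonnegative weights.\<close>
  also have "\<dots> = (\<Sum>l | blk l = i. x $ l * c $ k)"
    by (simp add: sum_distrib_right flip: sx)
  also have "\<dots> \<le> (\<Sum>l | blk l = i. x $ l * c $ l)"
    by (intro sum_mono mult_left_mono) (auto simp: k x0)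
  also have "\<dots> = block blk i x \<bullet> block blk i c"
    by (rule inner_block[symmetric])
  finally have "f y \<le> f x"
    using g[of x] g[of y] by (simp add: bg ub) (simp add: block_grad_def c_def)
  then show thesis using that fy ub k(1) b by blast
qed

text \<open>Induction on the set \<open>S\<close> of blocks already concentrated at one coordinate,
  one improvement step per block; \<open>S = {1..n1}\<close> yields a vertex.\<close>

lemma vertex_dominates_feasible:
  assumes lin: "block_linear n1 blk f" and ne: "\<And>i. i \<in> {1..n1} \<Longrightarrow> \<exists>k. blk k = i"
    and \<alpha>: "\<And>i. i \<in> {1..n1} \<Longrightarrow> \<alpha> i \<ge> 0" and feas: "feasible n1 blk \<alpha> x"
  obtains y where "vertex n1 blk \<alpha> y" "f y \<le> f x"
proof -
  have "\<exists>y. feasible n1 blk \<alpha> y \<and> f y \<le> f x \<and>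
      (\<forall>i\<in>S. \<exists>k. blk k = i \<and> block blk i y = axis k (\<alpha> i))"
    if "finite S" "S \<subseteq> {1..n1}" for S
    using that
  proof (induction S rule: finite_induct)
    case empty
    then show ?case using feas by auto
  next
    case (insert i S)
    then obtain y where y: "feasible n1 blk \<alpha> y" "f y \<le> f x"
      "\<forall>j\<in>S. \<exists>k. blk k = j \<and> block blk j y = axis k (\<alpha> j)" by auto
    have i: "i \<in> {1..n1}" using insert.prems by simp
    obtain z k where z: "feasible n1 blk \<alpha> z" "f z \<le> f y"
      "unblock blk i z = unblock blk i y" "blk k = i" "block blk i z = axis k (\<alpha> i)"
      using block_linear_improve[OF lin i ne[OF i] \<alpha>[OF i] y(1)] by metis
    \<comment> \<open>Blocks treated earlier lie outside block \<open>i\<close>, so the new step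
      leaves them concentrated.\<close>
    have "block blk j z = block blk j y" if "j \<in> S" for j
    proof -
      have "j \<noteq> i" using that insert.hyps by auto
      then show ?thesis using unblock_eqD[OF z(3)] by (auto simp: block_def vec_eq_iff)
    qed
    with y z show ?case by (intro exI[of _ z]) auto
  qed
  from this[of "{1..n1}"] show thesis
    using that by (auto simp: vertex_def)
qed

text \<open>Every coordinate lies in some block, so each entry of a vertex is \<open>0\<close> or
  some \<open>\<alpha> i\<close>. Only finitely many functions map the finite index type into this
  finite set of values.\<close>

lemma finite_vertices:
  assumes "range blk \<subseteq> {1..n1}"
  shows "finite {x. vertex n1 blk \<alpha> x}"
proof -
  let ?A = "insert 0 (\<alpha> ` {1..n1})"
  have "x $ l \<in> ?A" if v: "vertex n1 blk \<alpha> x" for x l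
  proof -
    have i: "blk l \<in> {1..n1}" using assms by blast
    then obtain k where "block blk (blk l) x = axis k (\<alpha> (blk l))"
      using v i unfolding vertex_def by blast
    from block_eq_axisD[OF this refl] have "x $ l = 0 \<or> x $ l = \<alpha> (blk l)" by simp
    with i show ?thesis by blast
  qed
  then have "vec_nth x \<in> UNIV \<rightarrow>\<^sub>E ?A" if "vertex n1 blk \<alpha> x" for x
    using that by (intro PiE_I) simp_all
  then have "{x. vertex n1 blk \<alpha> x} \<subseteq> vec_lambda ` (UNIV \<rightarrow>\<^sub>E ?A)"
    by (metis (no_types, lifting) image_eqI mem_Collect_eq subsetI vec_nth_inverse)
  moreover have "finite (vec_lambda ` ((UNIV :: 'a set) \<rightarrow>\<^sub>E ?A))"
    by (intro finite_imageI finite_PiE) auto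
  ultimately show ?thesis by (rule finite_subset)
qed

text \<open>\<open>blk\<close> maps the support of a vertex bijectively onto \<open>{1..n1}\<close>:
  as \<open>\<alpha> i \<noteq> 0\<close>, each block contains exactly one nonzero entry.\<close>

lemma l0_vertex:
  assumes rng: "range blk \<subseteq> {1..n1}" and \<alpha>: "\<And>i. i \<in> {1..n1} \<Longrightarrow> \<alpha> i \<noteq> 0"
    and v: "vertex n1 blk \<alpha> x"
  shows "l0 x = n1"
proof -
  have *: "\<exists>k. blk k = i \<and> (\<forall>l. blk l = i \<longrightarrow> (x $ l \<noteq> 0 \<longleftrightarrow> l = k))" if i: "i \<in> {1..n1}" for i
  proof -
    obtain k where k: "blk k = i" "block blk i x = axis k (\<alpha> i)"
      using v i unfolding vertex_def by blast
    from block_eq_axisD[OF k(2)] k(1) \<alpha>[OF i] show ?thesis by auto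
  qed
  have "inj_on blk {k. x $ k \<noteq> 0}"
  proof (rule inj_onI)
    fix k l assume kl: "k \<in> {k. x $ k \<noteq> 0}" "l \<in> {k. x $ k \<noteq> 0}" "blk k = blk l"
    have "blk k \<in> {1..n1}" using rng by blast
    from *[OF this] obtain p where "\<And>j. blk j = blk k \<Longrightarrow> x $ j \<noteq> 0 \<longleftrightarrow> j = p" by blast
    from this[of k] this[of l] kl show "k = l" by simp
  qed
  moreover have "blk ` {k. x $ k \<noteq> 0} = {1..n1}"
  proof
    show "blk ` {k. x $ k \<noteq> 0} \<subseteq> {1..n1}" using rng by auto
    show "{1..n1} \<subseteq> blk ` {k. x $ k \<noteq> 0}"
    proof
      fix i assume "i \<in> {1..n1}"
      from *[OF this] obtain k where "blk k = i" "x $ k \<noteq> 0" by blast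
      then show "i \<in> blk ` {k. x $ k \<noteq> 0}" by blast
    qed
  qed
  ultimately show ?thesis using card_image[of blk "{k. x $ k \<noteq> 0}"] by (simp add: l0_def)
qed

text \<open>Spreading each mass evenly over its block provides a feasible point; the vertex
  dominating it shows that vertices exist.\<close>

lemma feasible_uniform:
  assumes ne: "\<And>i. i \<in> {1..n1} \<Longrightarrow> \<exists>k. blk k = i"
    and rng: "range blk \<subseteq> {1..n1}" and \<alpha>: "\<And>i. i \<in> {1..n1} \<Longrightarrow> \<alpha> i \<ge> 0"
  shows "feasible n1 blk \<alpha> (\<chi> k. \<alpha> (blk k) / real (card {l. blk l = blk k}))"
proof -
  have "\<alpha> (blk k) \<ge> 0" for k using \<alpha> rng by blast
  moreover have "card {l. blk l = i} \<noteq> 0" if "i \<in> {1..n1}" for i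
    using ne[OF that] by auto
  ultimately show ?thesis by (auto simp: feasible_def less_eq_vec_def)
qed

theorem corollary2:
  fixes n1 :: nat and m :: "nat \<Rightarrow> nat" and \<alpha> :: "nat \<Rightarrow> real"
    and blk :: "'n::finite \<Rightarrow> nat" and f :: "real^'n \<Rightarrow> real"
  assumes "n1 > 0"
    and "\<And>i. i \<in> {1..n1} \<Longrightarrow> m i > 0"
    and "(\<Sum>i=1..n1. m i) = CARD('n)"
    and "\<And>i. i \<in> {1..n1} \<Longrightarrow> \<alpha> i > 0"
    and "block_partition n1 m blk"
    and "block_linear n1 blk f"
  shows "\<exists>x. is_arg_min f (feasible n1 blk \<alpha>) x \<and> l0 x = n1 \<and>
             is_arg_min f (\<lambda>y. feasible n1 blk \<alpha> y \<and> l0 y \<le> n1) x"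
proof -
  have rng: "range blk \<subseteq> {1..n1}" and card: "\<And>i. i \<in> {1..n1} \<Longrightarrow> card {k. blk k = i} = m i"
    using assms(5) by (auto simp: block_partition_def)
  have ne: "\<exists>k. blk k = i" if "i \<in> {1..n1}" for i
  proof -
    have "card {k. blk k = i} > 0" using card[OF that] assms(2)[OF that] by simp
    then show ?thesis by (auto simp: card_gt_0_iff)
  qed
  have \<alpha>: "\<alpha> i \<ge> 0" if "i \<in> {1..n1}" for i using assms(4)[OF that] by simp
  let ?V = "{x. vertex n1 blk \<alpha> x}"
  have dom: "\<exists>v\<in>?V. f v \<le> f y" if y: "feasible n1 blk \<alpha> y" for y
  proof -
    obtain v where "vertex n1 blk \<alpha> v" "f v \<le> f y"
      by (rule vertex_dominates_feasible[OF assms(6) ne \<alpha> y])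
    then show ?thesis by blast
  qed
  have "finite ?V" by (rule finite_vertices[OF rng])
  moreover have "?V \<noteq> {}"
    using dom[OF feasible_uniform[OF ne rng \<alpha>]] by blast
  ultimately obtain x where x: "vertex n1 blk \<alpha> x" "\<And>v. vertex n1 blk \<alpha> v \<Longrightarrow> f x \<le> f v"
    using arg_min_if_finite(1)[of ?V f] arg_min_least[of ?V _ f] by (metis mem_Collect_eq)
  \<comment> \<open>The vertex dominating \<open>y\<close> is in turn no better than the best vertex
    \<open>x\<close>.\<close>
  have "f x \<le> f y" if "feasible n1 blk \<alpha> y" for y
    using dom[OF that] x(2) by force
  moreover have "l0 x = n1"
    using l0_vertex[OF rng _ x(1)] assms(4) by (metis less_irrefl)
  \<comment> \<open>Since \<open>l0 x = n1\<close>, the point \<open>x\<close> survives the sparsity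
    constraint, and minimality over all feasible points passes to the smaller set.\<close>
  ultimately show ?thesis
    using x(1) by (intro exI[of _ x]) (auto simp: is_arg_min_def vertex_def not_less)
qed

end
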